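(* Let $n\ge2$. The maps $w\mapsto\lambda(w)$ and $a\mapsto w_a$ are mutually inverse bijections between (i) $\Omega'_n$ and the set of weakly increasing sequences of $n$ integers whose terms sum to zero; and (ii) $\Omega_n$ and the set of weakly increasing, antisymmetric sequences of $n$ integers.
   Context: $\tilde S_n$ is the group of bijections $w:\mathbb Z\to\mathbb Z$ with $w(i+n)=w(i)+n$ and $\sum_{i=1}^nw(i)=\sum_{i=1}^ni$, a Coxeter group with simple generators $s_0,\dots,s_{n-1}$, $s_i$ mapping $j\mapsto j+1$ if $j\equiv i$, $j\mapsto j-1$ if $j\equiv i+1\pmod n$, fixing $j$ otherwise; $\ell$ is length; $[n]=\{1,\dots,n\}$; $\tau_n(i)=n+1-i$. Define $\Omega_n=\{w\in\tilde S_n: w^2=1,\ \ell(s_iw)=\ell(ws_i)=\ell(w)+1\ \forall i\in[n-1]\}$ and $\Omega'_n=\{w\in\tilde S_n:(\tau_nw)^2=1,\ \ell(s_iw)=\ell(ws_i)=\ell(w)+1\ \forall i\in[n-1]\}$. For $w\in\tilde S_n$, $\lambda(w)=(\lambda_1(w),\dots,\lambda_n(w))$ with $\lambda_i(w)=\lfloor (w(i)-1)/n\rfloor$. A sequence $a=(a_1,\dots,a_n)$ is antisymmetric if $a_i+a_{n+1-i}=0$ for all $i$. For an integer sequence $a$, let $I_1,\dots,I_m$ be the maximal sets of consecutive indices in $[n]$ (in order) on which $a$ is constant, $v_i$ the common value of $a$ on $I_i$, and $J_i=\{n+1-t:t\in I_i\}$; $w_a:\mathbb Z\to\mathbb Z$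 is the unique map which restricts to an order-preserving bijection $nk+I_i\to n(k+v_i)+J_i$ for each $i\in[m]$ and $k\in\mathbb Z$. *)

theory Defs
  imports Complex_Main "HOL-Number_Theory.Cong" "HOL-Library.FuncSet"
begin

section \<open>The affine symmetric group\<close>

text \<open>The rank \<open>n\<close> is an integer, so that no coercions are needed; the group operation is
  composition of maps.\<close>

definition affine_sym :: "int \<Rightarrow> (int \<Rightarrow> int) set" where
  "affine_sym n =
    {w. bij w \<and> (\<forall>i. w (i + n) = w i + n) \<and> (\<Sum>i\<in>{1..n}. w i) = (\<Sum>i\<in>{1..n}. i)}"

definition simple_gen :: "int \<Rightarrow> int \<Rightarrow> int \<Rightarrow> int" where
  "simple_gen n i j =
    (if [j = i] (mod n) then j + 1 else if [j = i + 1] (mod n) then j - 1 else j)"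

text \<open>Coxeter length: the least number of factors in an expression as a product of the simple
  generators \<open>s\<^sub>0, \<dots>, s\<^sub>n\<^sub>-\<^sub>1\<close>. It is only meaningful on \<^term>\<open>affine_sym n\<close>.\<close>

definition cox_length :: "int \<Rightarrow> (int \<Rightarrow> int) \<Rightarrow> nat" where
  "cox_length n w =
    (LEAST k. \<exists>is. length is = k \<and> set is \<subseteq> {0..n - 1} \<and>
                   w = foldr (\<circ>) (map (simple_gen n) is) id)"

text \<open>The reversal is taken on all of the integers. It is not an element of
  \<^term>\<open>affine_sym n\<close>, nor the \<open>n\<close>-periodic extension of the reversal of \<open>{1..n}\<close>.\<close>

definition rev_map :: "int \<Rightarrow> int \<Rightarrow> int" where
  "rev_map n i = n + 1 - i"

definition min_double_coset_elem :: "int \<Rightarrow> (int \<Rightarrow> int) \<Rightarrow> bool" where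
  "min_double_coset_elem n w \<longleftrightarrow>
    (\<forall>i\<in>{1..n - 1}. cox_length n (simple_gen n i \<circ> w) = cox_length n w + 1 \<and>
                     cox_length n (w \<circ> simple_gen n i) = cox_length n w + 1)"

definition Omega :: "int \<Rightarrow> (int \<Rightarrow> int) set" where
  "Omega n = {w \<in> affine_sym n. w \<circ> w = id \<and> min_double_coset_elem n w}"

definition Omega' :: "int \<Rightarrow> (int \<Rightarrow> int) set" where
  "Omega' n = {w \<in> affine_sym n.
     (rev_map n \<circ> w) \<circ> (rev_map n \<circ> w) = id \<and> min_double_coset_elem n w}"

section \<open>Integer sequences\<close>

text \<open>A sequence \<open>(a\<^sub>1, \<dots>, a\<^sub>n)\<close> is a function on the integers that is \<^term>\<open>undefined\<close>
  outside \<open>{1..n}\<close>.\<close>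

definition int_seqs :: "int \<Rightarrow> (int \<Rightarrow> int) set" where
  "int_seqs n = {1..n} \<rightarrow>\<^sub>E UNIV"

definition zero_sum_seqs :: "int \<Rightarrow> (int \<Rightarrow> int) set" where
  "zero_sum_seqs n = {a \<in> int_seqs n. mono_on {1..n} a \<and> (\<Sum>i\<in>{1..n}. a i) = 0}"

definition antisymmetric_seq :: "int \<Rightarrow> (int \<Rightarrow> int) \<Rightarrow> bool" where
  "antisymmetric_seq n a \<longleftrightarrow> (\<forall>i\<in>{1..n}. a i + a (n + 1 - i) = 0)"

definition antisymmetric_seqs :: "int \<Rightarrow> (int \<Rightarrow> int) set" where
  "antisymmetric_seqs n = {a \<in> int_seqs n. mono_on {1..n} a \<and> antisymmetric_seq n a}"

text \<open>Integer \<open>div\<close> by a positive number is the floor of the rational quotient.\<close>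

definition lambda_seq :: "int \<Rightarrow> (int \<Rightarrow> int) \<Rightarrow> int \<Rightarrow> int" where
  "lambda_seq n w = (\<lambda>i\<in>{1..n}. (w i - 1) div n)"

section \<open>The map attached to a sequence\<close>

definition const_run :: "int \<Rightarrow> (int \<Rightarrow> int) \<Rightarrow> int set \<Rightarrow> bool" where
  "const_run n a I \<longleftrightarrow>
    (\<exists>p q. 1 \<le> p \<and> p \<le> q \<and> q \<le> n \<and> I = {p..q}) \<and> (\<exists>v. \<forall>t\<in>I. a t = v)"

definition blocks :: "int \<Rightarrow> (int \<Rightarrow> int) \<Rightarrow> int set set" where
  "blocks n a = {I. const_run n a I \<and> (\<forall>I'. const_run n a I' \<and> I \<subseteq> I' \<longrightarrow> I' = I)}"

definition seq_map :: "int \<Rightarrow> (int \<Rightarrow> int) \<Rightarrow> int \<Rightarrow> int" where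
  "seq_map n a = (THE w. \<forall>I\<in>blocks n a. \<forall>v. (\<forall>t\<in>I. a t = v) \<longrightarrow>
     (\<forall>k. bij_betw w ((\<lambda>t. n * k + t) ` I) ((\<lambda>t. n * (k + v) + (n + 1 - t)) ` I) \<and>
          mono_on ((\<lambda>t. n * k + t) ` I) w))"

definition mutually_inverse_bijections ::
    "('a \<Rightarrow> 'b) \<Rightarrow> ('b \<Rightarrow> 'a) \<Rightarrow> 'a set \<Rightarrow> 'b set \<Rightarrow> bool" where
  "mutually_inverse_bijections f g A B \<longleftrightarrow>
    bij_betw f A B \<and> bij_betw g B A \<and> (\<forall>x\<in>A. g (f x) = x) \<and> (\<forall>y\<in>B. f (g y) = y)"

end

theory Submission imports Defs begin

text \<open>By the exchange property, \<open>\<ell>(w s\<^sub>i) = \<ell>(w) + 1\<close> if and only if \<open>w i < w (i + 1)\<close>, and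
  likewise on the left with the inverse of \<open>w\<close>; so the minimal double coset elements are the \<open>w\<close>
  for which \<open>w\<close> and its inverse increase on \<open>{1..n}\<close>. Write \<open>w t = n \<lambda>\<^sub>t + \<sigma> t\<close> with \<open>\<sigma>\<close> a
  permutation of \<open>{1..n}\<close>. Each of the two involution conditions makes \<open>\<sigma>\<close> followed by the
  reversal preserve the blocks of \<open>\<lambda>\<close>, and \<open>\<sigma>\<close> increases on each block, so \<open>\<lambda>\<close> determines
  \<open>w\<close>. For the converse, antisymmetric sequences have zero sum, so the length condition need
  only be checked for \<open>\<Omega>'\<close>, where the inverse of \<open>w\<close> is its conjugate by the reversal.\<close>

section \<open>Words in the simple generators\<close>

definition gen_prod :: "int \<Rightarrow> int list \<Rightarrow> int \<Rightarrow> int" where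
  "gen_prod n is = foldr (\<circ>) (map (simple_gen n) is) id"

text \<open>\<open>cox_length\<close> is a \<open>LEAST\<close>, which is informative only if some
  word exists. This predicate carries that existence; \<open>affine_sym_generated\<close> supplies
  it for the whole group.\<close>

definition generated :: "int \<Rightarrow> (int \<Rightarrow> int) \<Rightarrow> bool" where
  "generated n w \<longleftrightarrow> (\<exists>is. set is \<subseteq> {0..n - 1} \<and> gen_prod n is = w)"

lemma gen_prod_Nil [simp]: "gen_prod n [] = id"
  and gen_prod_Cons [simp]: "gen_prod n (i # is) = simple_gen n i \<circ> gen_prod n is"
  by (simp_all add: gen_prod_def)

lemma gen_prod_append: "gen_prod n (is @ js) = gen_prod n is \<circ> gen_prod n js"
  by (induction "is") (auto simp: comp_assoc)

lemma not_cong_succ: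
  fixes n :: int
  assumes "n \<ge> 2"
  shows "\<not> [i + 1 = i] (mod n)"
proof
  assume "[i + 1 = i] (mod n)"
  then have "n dvd 1" by (simp add: cong_iff_dvd_diff)
  then show False using assms by (auto dest: zdvd_imp_le)
qed

lemma simple_gen_cong: "[j = i] (mod n) \<Longrightarrow> simple_gen n i j = j + 1"
  by (simp add: simple_gen_def)

lemma simple_gen_cong_succ:
  assumes "n \<ge> 2" "[j = i + 1] (mod n)"
  shows "simple_gen n i j = j - 1"
proof -
  have "\<not> [j = i] (mod n)"
    using not_cong_succ[OF assms(1), of i] assms(2) by (metis cong_sym cong_trans)
  then show ?thesis using assms(2) by (simp add: simple_gen_def)
qed

lemma simple_gen_invol:
  assumes "n \<ge> 2"
  shows "simple_gen n i (simple_gen n i j) = j"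
proof -
  consider "[j = i] (mod n)" | "[j = i + 1] (mod n)"
    | "\<not> [j = i] (mod n)" "\<not> [j = i + 1] (mod n)" by blast
  then show ?thesis
  proof cases
    case 1
    then have "[j + 1 = i + 1] (mod n)" by (intro cong_add) auto
    then show ?thesis using 1 assms by (simp add: simple_gen_cong simple_gen_cong_succ)
  next
    case 2
    then have "[j - 1 = i + 1 - 1] (mod n)" by (intro cong_diff) auto
    then show ?thesis using 2 assms by (simp add: simple_gen_cong simple_gen_cong_succ)
  next
    case 3
    then show ?thesis by (simp add: simple_gen_def)
  qed
qed

lemma simple_gen_comp_self: "n \<ge> 2 \<Longrightarrow> simple_gen n i \<circ> simple_gen n i = id"
  by (auto simp: simple_gen_invol)

lemma bij_simple_gen: "n \<ge> 2 \<Longrightarrow> bij (simple_gen n i)"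
  using o_bij simple_gen_comp_self by blast

lemma simple_gen_shift: "simple_gen n i (j + n) = simple_gen n i j + n"
proof -
  have "[j + n = k] (mod n) \<longleftrightarrow> [j = k] (mod n)" for k
    by (simp add: cong_def)
  then show ?thesis by (simp add: simple_gen_def)
qed

lemma bij_gen_prod: "n \<ge> 2 \<Longrightarrow> bij (gen_prod n is)"
  by (induction "is") (auto intro: bij_comp bij_simple_gen)

lemma gen_prod_shift: "gen_prod n is (j + n) = gen_prod n is j + n"
  by (induction "is") (auto simp: simple_gen_shift)

lemma periodic_shift:
  fixes w :: "int \<Rightarrow> int"
  assumes "\<And>i. w (i + n) = w i + n"
  shows "w (j + n * m) = w j + n * m"
proof (induction m rule: int_induct[where k = 0])
  case base
  show ?case by simp
next
  case (step1 m)
  then show ?case using assms[of "j + n * m"] by (simp add: algebra_simps)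
next
  case (step2 m)
  then show ?case using assms[of "j + n * (m - 1)"] by (simp add: algebra_simps)
qed

lemma periodic_cong:
  fixes w :: "int \<Rightarrow> int"
  assumes "inj w" "\<And>i. w (i + n) = w i + n"
  shows "[w x = w y] (mod n) \<longleftrightarrow> [x = y] (mod n)"
proof
  assume "[w x = w y] (mod n)"
  then obtain k where "w x = w y + n * k" by (metis cong_iff_lin cong_sym)
  then have "w x = w (y + n * k)" using periodic_shift[of w n] assms(2) by simp
  then have "x = y + n * k" using assms(1) by (simp add: inj_eq)
  then show "[x = y] (mod n)" by (simp add: cong_def)
next
  assume "[x = y] (mod n)"
  then obtain k where "x = y + n * k" by (metis cong_iff_lin cong_sym)
  then show "[w x = w y] (mod n)" using periodic_shift[of w n] assms(2) by (simp add: cong_def)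
qed

section \<open>Inversions and the exchange property\<close>

text \<open>A simple generator moves each integer by at most one, so it can reverse the order of two
  integers only if they are neighbours and the smaller one is moved up.\<close>

lemma simple_gen_inversion:
  assumes "n \<ge> 2" "x < y" "simple_gen n i x > simple_gen n i y"
  shows "[x = i] (mod n)" "y = x + 1"
proof -
  have b: "simple_gen n i z \<ge> z - 1" "simple_gen n i z \<le> z + 1" for z
    by (simp_all add: simple_gen_def)
  show *: "y = x + 1" using b(2)[of x] b(1)[of y] assms by linarith
  have "simple_gen n i x > x" using b(1)[of y] * assms(3) by linarith
  then show "[x = i] (mod n)" by (auto simp: simple_gen_def split: if_splits)
qed

text \<open>Moved past \<open>v\<close>, the generator at \<open>i\<close> becomes the swap of
  \<open>v i\<close> with \<open>v (i + 1)\<close> and of their translates. When these values are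
  neighbours, this is again a simple generator, and only the residue of \<open>v i\<close>
  matters.\<close>

lemma conj_simple_gen:
  assumes n: "n \<ge> 2" and v: "inj v" "\<And>j. v (j + n) = v j + n"
    and s: "[v i = s] (mod n)" "v (i + 1) = v i + 1"
  shows "simple_gen n s \<circ> v = v \<circ> simple_gen n i"
proof
  fix j
  have c: "[v j = s] (mod n) \<longleftrightarrow> [j = i] (mod n)"
    using periodic_cong[OF v] s(1) by (metis cong_sym cong_trans)
  have "[v (i + 1) = s + 1] (mod n)" using s by (auto intro: cong_add)
  then have c': "[v j = s + 1] (mod n) \<longleftrightarrow> [j = i + 1] (mod n)"
    using periodic_cong[OF v] by (metis cong_sym cong_trans)
  have up: "v (j + 1) = v j + 1" if h: "[j = i] (mod n)" for j
  proof -
    obtain k where k: "j = i + n * k" using h by (metis cong_iff_lin cong_sym)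
    have "v (j + 1) = v (i + 1) + n * k"
      using periodic_shift[of v n "i + 1" k] v(2) k by (simp add: algebra_simps)
    moreover have "v j = v i + n * k" using periodic_shift[of v n i k] v(2) k by simp
    ultimately show ?thesis using s(2) by simp
  qed
  have dn: "v (j - 1) = v j - 1" if h: "[j = i + 1] (mod n)"
  proof -
    have "[j - 1 = i + 1 - 1] (mod n)" using h by (intro cong_diff) auto
    then show ?thesis using up[of "j - 1"] by simp
  qed
  show "(simple_gen n s \<circ> v) j = (v \<circ> simple_gen n i) j"
    using c c' up[of j] dn by (auto simp: simple_gen_def)
qed

text \<open>The letter to delete is the one at which, reading the word from the right, the images of
  \<open>i\<close> and \<open>i + 1\<close> change their order.\<close>

lemma exchange:
  assumes n: "n \<ge> 2" and "set is \<subseteq> S" "gen_prod n is i > gen_prod n is (i + 1)"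
  shows "\<exists>js. set js \<subseteq> S \<and> length is = length js + 1 \<and>
              gen_prod n js = gen_prod n is \<circ> simple_gen n i"
  using assms(2,3)
proof (induction "is")
  case Nil
  then show ?case by simp
next
  case (Cons s ks)
  let ?v = "gen_prod n ks"
  have inj: "inj ?v" using bij_gen_prod[OF n] by (simp add: bij_is_inj)
  show ?case
  proof (cases "?v i > ?v (i + 1)")
    case True
    then obtain js where "set js \<subseteq> S" "length ks = length js + 1"
      "gen_prod n js = ?v \<circ> simple_gen n i" using Cons.IH Cons.prems(1) by fastforce
    then show ?thesis using Cons.prems by (intro exI[of _ "s # js"]) (auto simp: comp_assoc)
  next
    case False
    moreover have "?v i \<noteq> ?v (i + 1)" using inj by (simp add: inj_eq)
    ultimately have lt: "?v i < ?v (i + 1)" by simp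
    \<comment> \<open>Here \<open>s\<close> reverses the order of \<open>?v i\<close> and
      \<open>?v (i + 1)\<close>, so these are neighbours; moved past \<open>?v\<close>, the letter
      cancels against the appended generator.\<close>
    have "simple_gen n s \<circ> ?v = ?v \<circ> simple_gen n i"
      using simple_gen_inversion[OF n lt, of s] Cons.prems
      by (intro conj_simple_gen[OF n inj gen_prod_shift]) auto
    then have "gen_prod n ks = gen_prod n (s # ks) \<circ> simple_gen n i"
      using simple_gen_comp_self[OF n, of i] by (simp add: comp_assoc)
    moreover have "set ks \<subseteq> S" "length (s # ks) = length ks + 1" using Cons.prems(1) by simp_all
    ultimately show ?thesis by blast
  qed
qed

lemma gen_prod_rev:
  assumes "n \<ge> 2"
  shows "gen_prod n (rev is) \<circ> gen_prod n is = id"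
proof (induction "is")
  case Nil
  show ?case by simp
next
  case (Cons s ks)
  have "gen_prod n (rev (s # ks)) \<circ> gen_prod n (s # ks)
      = gen_prod n (rev ks) \<circ> (simple_gen n s \<circ> simple_gen n s) \<circ> gen_prod n ks"
    by (simp add: gen_prod_append comp_assoc)
  then show ?case by (simp only: Cons simple_gen_comp_self[OF assms] comp_id)
qed

section \<open>Coxeter length\<close>

lemma cox_length_le:
  assumes "set is \<subseteq> {0..n - 1}" "gen_prod n is = w"
  shows "cox_length n w \<le> length is"
  unfolding cox_length_def
  by (rule Least_le) (use assms in \<open>auto simp: gen_prod_def\<close>)

lemma reduced_word:
  assumes "generated n w"
  obtains "is" where "set is \<subseteq> {0..n - 1}" "gen_prod n is = w" "length is = cox_length n w"
proof -
  have "\<exists>k is. length is = k \<and> set is \<subseteq> {0..n - 1} \<and>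
    w = foldr (\<circ>) (map (simple_gen n) is) id"
    using assms by (auto simp: generated_def gen_prod_def)
  from LeastI_ex[OF this] show ?thesis
    using that unfolding cox_length_def[symmetric] gen_prod_def by metis
qed

lemma generated_comp_simple:
  assumes "generated n w" "i \<in> {0..n - 1}"
  shows "generated n (w \<circ> simple_gen n i)"
proof -
  obtain "is" where "set is \<subseteq> {0..n - 1}" "gen_prod n is = w"
    using assms(1) by (auto simp: generated_def)
  then show ?thesis unfolding generated_def using assms(2)
    by (intro exI[of _ "is @ [i]"]) (auto simp: gen_prod_append)
qed

text \<open>Appending a letter gives the upper bound. For the lower bound,
  \<open>w \<circ> simple_gen n i\<close> has a descent at \<open>i\<close>, so
  \<open>exchange\<close> turns its shortest word into a word for \<open>w\<close> with one letter
  fewer.\<close>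

lemma cox_length_comp_simple:
  assumes n: "n \<ge> 2" and w: "generated n w" and i: "i \<in> {0..n - 1}" and lt: "w i < w (i + 1)"
  shows "cox_length n (w \<circ> simple_gen n i) = cox_length n w + 1"
proof (rule antisym)
  obtain "is" where "set is \<subseteq> {0..n - 1}" "gen_prod n is = w" "length is = cox_length n w"
    using reduced_word[OF w] .
  then show "cox_length n (w \<circ> simple_gen n i) \<le> cox_length n w + 1"
    using cox_length_le[of "is @ [i]" n] i by (auto simp: gen_prod_append)
next
  let ?u = "w \<circ> simple_gen n i"
  obtain "is" where "is": "set is \<subseteq> {0..n - 1}" "gen_prod n is = ?u" "length is = cox_length n ?u"
    using reduced_word[OF generated_comp_simple[OF w i]] .
  have "?u i > ?u (i + 1)"
    using lt n by (simp add: simple_gen_cong simple_gen_cong_succ)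
  then obtain js where js: "set js \<subseteq> {0..n - 1}" "length is = length js + 1"
    "gen_prod n js = ?u \<circ> simple_gen n i"
    using exchange[OF n "is"(1), of i] "is"(2) by auto
  have "gen_prod n js = w" using js(3) simple_gen_comp_self[OF n] by (simp add: comp_assoc)
  then have "cox_length n w \<le> length js" using cox_length_le js(1) by blast
  then show "cox_length n w + 1 \<le> cox_length n ?u" using js(2) "is"(3) by simp
qed

text \<open>The generators are involutions, so reversing a word inverts its product.\<close>

lemma generated_inverse:
  assumes n: "n \<ge> 2" and w: "generated n w" and inv: "w \<circ> u = id"
  shows "generated n u" "cox_length n u \<le> cox_length n w"
proof -
  obtain "is" where "is": "set is \<subseteq> {0..n - 1}" "gen_prod n is = w" "length is = cox_length n w"
    using reduced_word[OF w] .
  have "gen_prod n (rev is) = gen_prod n (rev is) \<circ> (w \<circ> u)" by (simp add: inv)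
  also have "\<dots> = u" using gen_prod_rev[OF n, of "is"] "is"(2) by (simp flip: comp_assoc)
  finally have u: "gen_prod n (rev is) = u" .
  show "generated n u" unfolding generated_def using u "is"(1) by (intro exI[of _ "rev is"]) auto
  show "cox_length n u \<le> cox_length n w" using cox_length_le[OF _ u] "is" by simp
qed

lemma cox_length_inverse:
  assumes "n \<ge> 2" "generated n w" "w \<circ> u = id" "u \<circ> w = id"
  shows "cox_length n u = cox_length n w"
  using generated_inverse[OF assms(1,2,3)] generated_inverse[OF assms(1) _ assms(4)]
  by (simp add: antisym)

text \<open>Inversion preserves length and turns left multiplication of \<open>w\<close> into right
  multiplication of \<open>u\<close>.\<close>

lemma cox_length_simple_comp:
  assumes n: "n \<ge> 2" and w: "generated n w" and inv: "w \<circ> u = id" "u \<circ> w = id"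
    and i: "i \<in> {0..n - 1}" and lt: "u i < u (i + 1)"
  shows "cox_length n (simple_gen n i \<circ> w) = cox_length n w + 1"
proof -
  have u: "generated n u" using generated_inverse[OF n w inv(1)] by simp
  let ?s = "simple_gen n i"
  have ss: "?s (?s x) = x" for x using simple_gen_invol[OF n] .
  have "w (u x) = x" "u (w x) = x" for x using inv by (auto simp: fun_eq_iff)
  then have "(u \<circ> ?s) \<circ> (?s \<circ> w) = id" "(?s \<circ> w) \<circ> (u \<circ> ?s) = id"
    using ss by (auto simp: fun_eq_iff)
  then have "cox_length n (?s \<circ> w) = cox_length n (u \<circ> ?s)"
    using cox_length_inverse[OF n generated_comp_simple[OF u i]] by blast
  then show ?thesis
    using cox_length_comp_simple[OF n u i lt] cox_length_inverse[OF n w inv] by simp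
qed

section \<open>Generation of the affine symmetric group\<close>

lemma sum_periodic:
  fixes g :: "int \<Rightarrow> int"
  assumes "n \<ge> 1" "\<And>j. g (j + n) = g j"
  shows "sum g {m..m + n - 1} = sum g {1..n}"
proof -
  have step: "sum g {m + 1..m + 1 + n - 1} = sum g {m..m + n - 1}" for m
  proof -
    have "{m..m + n - 1} = insert m {m + 1..m + n - 1}" using assms(1) by auto
    moreover have "{m + 1..m + 1 + n - 1} = insert (m + n) {m + 1..m + n - 1}"
      using assms(1) by auto
    ultimately show ?thesis using assms(2)[of m] by simp
  qed
  show ?thesis
  proof (induction m rule: int_induct[where k = 1])
    case base
    show ?case by simp
  next
    case (step1 i)
    then show ?case using step[of i] by simp
  next
    case (step2 i)
    then show ?case using step[of "i - 1"] by simp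
  qed
qed

lemma affine_symD:
  assumes "w \<in> affine_sym n"
  shows "bij w" "inj w" "w (i + n) = w i + n" "(\<Sum>i\<in>{1..n}. w i) = (\<Sum>i\<in>{1..n}. i)"
  using assms by (auto simp: affine_sym_def bij_is_inj)

text \<open>A window starting at \<open>i\<close> contains both \<open>i\<close> and
  \<open>i + 1\<close>, so the generator at \<open>0\<close>, which acts across the boundary of
  \<open>{1..n}\<close>, needs no separate case.\<close>

lemma sum_split_first_two:
  fixes g :: "int \<Rightarrow> int"
  assumes "n \<ge> 2" "\<And>j. g (j + n) = g j"
  shows "sum g {1..n} = g i + g (i + 1) + sum g {i + 2..i + n - 1}"
proof -
  have "{i..i + n - 1} = insert i (insert (i + 1) {i + 2..i + n - 1})" using assms(1) by auto
  then show ?thesis using sum_periodic[of n g i] assms by simp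
qed

lemma simple_gen_tail:
  assumes "j \<in> {i + 2..i + n - 1}"
  shows "simple_gen n i j = j"
proof -
  have "\<not> n dvd (j - i)" "\<not> n dvd (j - (i + 1))"
    using assms zdvd_imp_le[of n "j - i"] zdvd_imp_le[of n "j - (i + 1)"] by auto
  then show ?thesis by (simp add: simple_gen_def cong_iff_dvd_diff)
qed

lemma affine_sym_comp_simple:
  assumes n: "n \<ge> 2" and w: "w \<in> affine_sym n"
  shows "w \<circ> simple_gen n i \<in> affine_sym n"
proof -
  let ?u = "w \<circ> simple_gen n i"
  have per: "?u (j + n) = ?u j + n" for j
    using affine_symD(3)[OF w] by (simp add: simple_gen_shift)
  have tail: "(\<Sum>j\<in>{i + 2..i + n - 1}. ?u j - j) = (\<Sum>j\<in>{i + 2..i + n - 1}. w j - j)"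
    by (intro sum.cong) (auto simp: simple_gen_tail)
  have "(\<Sum>j\<in>{1..n}. ?u j - j) = (\<Sum>j\<in>{1..n}. w j - j)"
    using sum_split_first_two[OF n, of "\<lambda>j. ?u j - j" i] per tail
      sum_split_first_two[OF n, of "\<lambda>j. w j - j" i] affine_symD(3)[OF w] n
    by (simp add: simple_gen_cong simple_gen_cong_succ)
  then have "(\<Sum>j\<in>{1..n}. ?u j) = (\<Sum>j\<in>{1..n}. j)"
    using affine_symD(4)[OF w] by (simp add: sum_subtractf)
  then show ?thesis
    unfolding affine_sym_def using per bij_comp[OF bij_simple_gen[OF n] affine_symD(1)[OF w]]
    by blast
qed

text \<open>The measure that decreases in the sorting argument of
  \<open>affine_sym_generated\<close>. Without the squares the sum would vanish on all of
  \<open>affine_sym n\<close>.\<close>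

definition displacement :: "int \<Rightarrow> (int \<Rightarrow> int) \<Rightarrow> int" where
  "displacement n w = (\<Sum>j\<in>{1..n}. (w j - j)\<^sup>2)"

lemma displacement_comp_simple:
  assumes n: "n \<ge> 2" and w: "w \<in> affine_sym n" and gt: "w i > w (i + 1)"
  shows "displacement n (w \<circ> simple_gen n i) < displacement n w"
proof -
  let ?u = "w \<circ> simple_gen n i"
  have per: "?u (j + n) = ?u j + n" for j
    using affine_symD(3)[OF w] by (simp add: simple_gen_shift)
  have tail: "(\<Sum>j\<in>{i + 2..i + n - 1}. (?u j - j)\<^sup>2) = (\<Sum>j\<in>{i + 2..i + n - 1}. (w j - j)\<^sup>2)"
    by (intro sum.cong) (auto simp: simple_gen_tail)
  have "displacement n w - displacement n ?u = 2 * (w i - w (i + 1))"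
    unfolding displacement_def
    using sum_split_first_two[OF n, of "\<lambda>j. (?u j - j)\<^sup>2" i] per tail
      sum_split_first_two[OF n, of "\<lambda>j. (w j - j)\<^sup>2" i] affine_symD(3)[OF w] n
    by (simp add: simple_gen_cong simple_gen_cong_succ power2_eq_square algebra_simps)
  then show ?thesis using gt by simp
qed

lemma less_of_less_succ:
  fixes w :: "int \<Rightarrow> int"
  assumes "\<And>i. p \<le> i \<Longrightarrow> i < q \<Longrightarrow> w i < w (i + 1)" "p \<le> x" "x < y" "y \<le> q"
  shows "w x < w y"
proof -
  have "y \<le> q \<longrightarrow> w x < w y"
    using assms(3)
  proof (induction y rule: int_gr_induct)
    case base
    show ?case using assms(1)[of x] assms(2) by simp
  next
    case (step y)
    then show ?case using assms(1)[of y] assms(2) by fastforce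
  qed
  then show ?thesis using assms(4) by simp
qed

text \<open>By periodicity \<open>w\<close> increases everywhere. An increasing bijection of the
  integers leaves no gaps, so it is a translation, and the normalised sum forces the shift to be
  zero.\<close>

lemma affine_sym_no_descent:
  assumes n: "n \<ge> 2" and w: "w \<in> affine_sym n" and inc: "\<And>i. i \<in> {0..n - 1} \<Longrightarrow> w i < w (i + 1)"
  shows "w = id"
proof -
  have inc': "w j < w (j + 1)" for j
  proof -
    have j: "j = j mod n + n * (j div n)" by simp
    have "w j = w (j mod n) + n * (j div n)"
      using periodic_shift[of w n "j mod n" "j div n"] affine_symD(3)[OF w] by simp
    moreover have "w (j + 1) = w (j mod n + 1) + n * (j div n)"
      using periodic_shift[of w n "j mod n + 1" "j div n"] affine_symD(3)[OF w] j
      by (simp add: algebra_simps)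
    ultimately show ?thesis using inc[of "j mod n"] n by simp
  qed
  have mono: "x < y \<Longrightarrow> w x < w y" for x y
    using less_of_less_succ[of x y w x y] inc' by blast
  have succ: "w (j + 1) = w j + 1" for j
  proof -
    \<comment> \<open>Surjectivity excludes a gap: the preimage of \<open>w j + 1\<close> lies to
      the right of \<open>j\<close>, so \<open>w (j + 1)\<close> cannot exceed this value.\<close>
    obtain x where x: "w x = w j + 1" using affine_symD(1)[OF w] by (metis bij_pointE)
    have "x > j" using x mono[of x j] by (cases x j rule: linorder_cases) auto
    then have "w (j + 1) \<le> w x" using mono[of "j + 1" x] by (cases "x = j + 1") auto
    then show ?thesis using x inc'[of j] by linarith
  qed
  have tr: "w j = j + w 0" for j
  proof (induction j rule: int_induct[where k = 0])
    case base
    show ?case by simp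
  next
    case (step1 i)
    then show ?case using succ[of i] by simp
  next
    case (step2 i)
    then show ?case using succ[of "i - 1"] by simp
  qed
  have "(\<Sum>i\<in>{1..n}. w i) = (\<Sum>i\<in>{1..n}. i) + n * w 0"
    using n by (subst tr) (simp add: sum.distrib)
  then have "w 0 = 0" using affine_symD(4)[OF w] n by simp
  then have "w j = j" for j using tr[of j] by simp
  then show ?thesis by auto
qed

text \<open>Bubble sort: removing a descent lowers \<open>displacement\<close>, and the identity is
  the only element without descents.\<close>

lemma affine_sym_generated:
  assumes n: "n \<ge> 2"
  shows "w \<in> affine_sym n \<Longrightarrow> generated n w"
proof (induction "nat (displacement n w)" arbitrary: w rule: less_induct)
  case less
  show ?case
  proof (cases "\<exists>i\<in>{0..n - 1}. w i > w (i + 1)")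
    case True
    then obtain i where i: "i \<in> {0..n - 1}" "w i > w (i + 1)" by auto
    let ?u = "w \<circ> simple_gen n i"
    have "displacement n ?u \<ge> 0" by (simp add: displacement_def sum_nonneg)
    then have "generated n ?u"
      using less.hyps[of ?u] displacement_comp_simple[OF n less.prems i(2)]
        affine_sym_comp_simple[OF n less.prems] by simp
    then have "generated n (?u \<circ> simple_gen n i)" using generated_comp_simple i(1) by blast
    then show ?thesis using simple_gen_comp_self[OF n] by (simp add: comp_assoc)
  next
    case False
    have "w i \<noteq> w (i + 1)" for i using affine_symD(2)[OF less.prems] by (simp add: inj_eq)
    then have "w = id" using False affine_sym_no_descent[OF n less.prems]
      by (metis linorder_neqE)
    then show ?thesis unfolding generated_def by (intro exI[of _ "[]"]) auto
  qed
qed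

section \<open>Minimal double coset elements as increasing maps\<close>

text \<open>A descent of \<open>w\<close> at \<open>i\<close> is an ascent of
  \<open>w \<circ> simple_gen n i\<close>, whose length would then be both one below and one above
  that of \<open>w\<close>.\<close>

lemma min_double_coset_increasing:
  assumes n: "n \<ge> 2" and w: "w \<in> affine_sym n" and m: "min_double_coset_elem n w"
  shows "strict_mono_on {1..n} w"
proof (rule strict_mono_onI)
  have step: "w i < w (i + 1)" if i: "1 \<le> i" "i < n" for i
  proof (rule ccontr)
    let ?u = "w \<circ> simple_gen n i"
    assume "\<not> w i < w (i + 1)"
    moreover have "w i \<noteq> w (i + 1)" using affine_symD(2)[OF w] by (simp add: inj_eq)
    ultimately have "?u i < ?u (i + 1)" using n by (simp add: simple_gen_cong simple_gen_cong_succ)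
    then have "cox_length n (?u \<circ> simple_gen n i) = cox_length n ?u + 1"
      using i n cox_length_comp_simple affine_sym_generated[OF n affine_sym_comp_simple[OF n w]]
      by simp
    moreover have "?u \<circ> simple_gen n i = w"
      using simple_gen_comp_self[OF n] by (simp add: comp_assoc)
    moreover have "cox_length n ?u = cox_length n w + 1"
      using m i unfolding min_double_coset_elem_def by simp
    ultimately show False by simp
  qed
  show "w r < w s" if "r \<in> {1..n}" "s \<in> {1..n}" "r < s" for r s
    using less_of_less_succ[of 1 n w r s] step that by simp
qed

lemma min_double_coset_increasingI:
  assumes n: "n \<ge> 2" and w: "w \<in> affine_sym n" and inv: "w \<circ> u = id" "u \<circ> w = id"
    and "strict_mono_on {1..n} w" "strict_mono_on {1..n} u"
  shows "min_double_coset_elem n w"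
  unfolding min_double_coset_elem_def
proof (intro ballI conjI)
  fix i assume i: "i \<in> {1..n - 1}"
  then have "w i < w (i + 1)" "u i < u (i + 1)"
    using assms(5,6) by (auto intro: strict_mono_onD)
  moreover have "i \<in> {0..n - 1}" using i by simp
  ultimately show "cox_length n (simple_gen n i \<circ> w) = cox_length n w + 1"
    "cox_length n (w \<circ> simple_gen n i) = cox_length n w + 1"
    using cox_length_simple_comp[OF n affine_sym_generated[OF n w] inv, of i]
      cox_length_comp_simple[OF n affine_sym_generated[OF n w], of i] by simp_all
qed

section \<open>Explicit form of the map attached to a sequence\<close>

definition level :: "int \<Rightarrow> (int \<Rightarrow> int) \<Rightarrow> int \<Rightarrow> int set" where
  "level n a t = {s \<in> {1..n}. a s = a t}"

text \<open>The reflection of a block in its midpoint. Followed by the reversal of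
  \<open>{1..n}\<close> it is the increasing bijection from a block to its reversed copy, since the
  two order reversals cancel.\<close>

definition block_flip :: "int \<Rightarrow> (int \<Rightarrow> int) \<Rightarrow> int \<Rightarrow> int" where
  "block_flip n a t = Min (level n a t) + Max (level n a t) - t"

lemma finite_level [simp]: "finite (level n a t)"
  by (rule finite_subset[of _ "{1..n}"]) (auto simp: level_def)

lemma level_self: "t \<in> {1..n} \<Longrightarrow> t \<in> level n a t"
  by (simp add: level_def)

lemma level_cong: "s \<in> level n a t \<Longrightarrow> level n a s = level n a t"
  by (auto simp: level_def)

lemma level_interval:
  assumes mono: "mono_on {1..n} a" and t: "t \<in> {1..n}"
  shows "level n a t = {Min (level n a t)..Max (level n a t)}"
proof (intro equalityI subsetI)
  fix s assume "s \<in> level n a t"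
  then show "s \<in> {Min (level n a t)..Max (level n a t)}" by simp
next
  let ?L = "level n a t"
  fix s assume s: "s \<in> {Min ?L..Max ?L}"
  have ne: "?L \<noteq> {}" using level_self[OF t] by blast
  have m: "Min ?L \<in> ?L" "Max ?L \<in> ?L" using ne by (auto intro: Min_in Max_in)
  then have s1: "s \<in> {1..n}" using s by (force simp: level_def)
  have m': "Min ?L \<in> {1..n}" "Max ?L \<in> {1..n}" "a (Min ?L) = a t" "a (Max ?L) = a t"
    using m unfolding level_def by blast+
  have "a (Min ?L) \<le> a s" "a s \<le> a (Max ?L)"
    using s by (auto intro!: mono_onD[OF mono] m'(1,2) s1)
  then show "s \<in> ?L" using m' s1 by (simp add: level_def)
qed

text \<open>A level set is itself a constant run and contains every constant run through any of its
  points, so it is the maximal one. This trades maximality for an explicit set.\<close>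

lemma blocks_eq_levels:
  assumes mono: "mono_on {1..n} a"
  shows "blocks n a = level n a ` {1..n}"
proof -
  have run: "const_run n a (level n a t)" if t: "t \<in> {1..n}" for t
  proof -
    let ?L = "level n a t"
    have ne: "?L \<noteq> {}" using level_self[OF t] by blast
    have m: "Min ?L \<in> ?L" "Max ?L \<in> ?L" using ne by (auto intro: Min_in Max_in)
    have "?L \<subseteq> {1..n}" by (auto simp: level_def)
    then have "1 \<le> Min ?L" "Max ?L \<le> n" using m by auto
    moreover have "Min ?L \<le> Max ?L" using m(1) by (intro Max_ge) auto
    moreover have "\<forall>s\<in>?L. a s = a t" by (simp add: level_def)
    ultimately show ?thesis
      unfolding const_run_def using level_interval[OF mono t] by blast
  qed
  have sub: "I \<subseteq> level n a t" if "const_run n a I" "t \<in> I" for I t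
    using that unfolding const_run_def level_def by fastforce
  show ?thesis
  proof (intro equalityI subsetI)
    fix I assume "I \<in> blocks n a"
    then have I: "const_run n a I" "\<And>I'. const_run n a I' \<Longrightarrow> I \<subseteq> I' \<Longrightarrow> I' = I"
      by (auto simp: blocks_def)
    then obtain t where t: "t \<in> I" "t \<in> {1..n}" unfolding const_run_def by force
    then have "level n a t = I" using I run sub by blast
    then show "I \<in> level n a ` {1..n}" using t by blast
  next
    fix I assume "I \<in> level n a ` {1..n}"
    then obtain t where t: "t \<in> {1..n}" "I = level n a t" by blast
    then have "I' = I" if "const_run n a I'" "I \<subseteq> I'" for I'
      using that sub[of I' t] level_self[OF t(1)] by blast
    then show "I \<in> blocks n a" using t run by (auto simp: blocks_def)
  qed
qed

lemma block_flip:
  assumes mono: "mono_on {1..n} a" and t: "t \<in> {1..n}"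
  shows "block_flip n a t \<in> level n a t" "block_flip n a t \<in> {1..n}"
    "a (block_flip n a t) = a t" "block_flip n a (block_flip n a t) = t"
proof -
  have "t \<in> {Min (level n a t)..Max (level n a t)}"
    using level_interval[OF mono t] level_self[OF t] by blast
  then have "block_flip n a t \<in> {Min (level n a t)..Max (level n a t)}"
    by (auto simp: block_flip_def)
  then show *: "block_flip n a t \<in> level n a t" using level_interval[OF mono t] by blast
  then show "block_flip n a t \<in> {1..n}" "a (block_flip n a t) = a t" by (auto simp: level_def)
  show "block_flip n a (block_flip n a t) = t"
    using level_cong[OF *] by (simp add: block_flip_def)
qed

text \<open>Strictly increasing integer values rise by at least one per step. Counting up from
  \<open>p\<close> bounds \<open>w\<close> below, counting down from \<open>q\<close> bounds it
  above, and equal lengths make the bounds meet.\<close>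

lemma bij_mono_interval_iff:
  fixes w :: "int \<Rightarrow> int"
  assumes "q - p = q' - p'"
  shows "bij_betw w {p..q} {p'..q'} \<and> mono_on {p..q} w \<longleftrightarrow> (\<forall>x\<in>{p..q}. w x = x - p + p')"
proof
  assume r: "bij_betw w {p..q} {p'..q'} \<and> mono_on {p..q} w"
  then have lt: "w x < w y" if "x \<in> {p..q}" "y \<in> {p..q}" "x < y" for x y
    using that mono_onD[of "{p..q}" w x y] inj_onD[of w "{p..q}" x y]
    by (fastforce simp: bij_betw_def)
  have mem: "w x \<in> {p'..q'}" if "x \<in> {p..q}" for x using r that bij_betwE by blast
  show "\<forall>x\<in>{p..q}. w x = x - p + p'"
  proof
    fix x assume x: "x \<in> {p..q}"
    have "x \<le> q \<longrightarrow> x - p + p' \<le> w x" if "p \<le> x" for x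
      using that
    proof (induction x rule: int_ge_induct)
      case base
      then show ?case using mem[of p] by auto
    next
      case (step i)
      then show ?case using lt[of i "i + 1"] by auto
    qed
    moreover have "p \<le> x \<longrightarrow> w x \<le> x - p + p'" if "x \<le> q" for x
      using that
    proof (induction x rule: int_le_induct)
      case base
      then show ?case using mem[of q] assms by auto
    next
      case (step i)
      then show ?case using lt[of "i - 1" i] by auto
    qed
    ultimately show "w x = x - p + p'" using x by (auto intro: antisym)
  qed
next
  assume r: "\<forall>x\<in>{p..q}. w x = x - p + p'"
  have "w ` {p..q} = (+) (p' - p) ` {p..q}" using r by (intro image_cong) auto
  also have "\<dots> = {p' - p + p..p' - p + q}" by simp
  also have "\<dots> = {p'..q'}" using assms by simp
  finally have "w ` {p..q} = {p'..q'}" .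
  then show "bij_betw w {p..q} {p'..q'} \<and> mono_on {p..q} w"
    using r by (auto simp: bij_betw_def inj_on_def mono_on_def)
qed

definition seq_map_spec :: "int \<Rightarrow> (int \<Rightarrow> int) \<Rightarrow> (int \<Rightarrow> int) \<Rightarrow> bool" where
  "seq_map_spec n a w \<longleftrightarrow> (\<forall>I\<in>blocks n a. \<forall>v. (\<forall>t\<in>I. a t = v) \<longrightarrow>
     (\<forall>k. bij_betw w ((\<lambda>t. n * k + t) ` I) ((\<lambda>t. n * (k + v) + (n + 1 - t)) ` I) \<and>
          mono_on ((\<lambda>t. n * k + t) ` I) w))"

text \<open>An order-preserving bijection between intervals of equal length is a translation, so the
  implicit description amounts to a formula on each translate of each block.\<close>

lemma seq_map_spec_iff:
  assumes mono: "mono_on {1..n} a"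
  shows "seq_map_spec n a w \<longleftrightarrow>
    (\<forall>t\<in>{1..n}. \<forall>k. w (n * k + t) = n * (k + a t) + (n + 1 - block_flip n a t))"
proof -
  have block: "(bij_betw w ((\<lambda>s. n * k + s) ` level n a t)
        ((\<lambda>s. n * (k + a t) + (n + 1 - s)) ` level n a t)
      \<and> mono_on ((\<lambda>s. n * k + s) ` level n a t) w) \<longleftrightarrow>
    (\<forall>s\<in>level n a t. w (n * k + s) = n * (k + a s) + (n + 1 - block_flip n a s))"
    if t: "t \<in> {1..n}" for t k
  proof -
    define p where "p = Min (level n a t)"
    define q where "q = Max (level n a t)"
    have L: "level n a t = {p..q}" using level_interval[OF mono t] by (simp add: p_def q_def)
    have dom: "(\<lambda>s. n * k + s) ` level n a t = {n * k + p..n * k + q}"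
      unfolding L by simp
    have "(\<lambda>s. n * (k + a t) + (n + 1 - s)) = (\<lambda>s. (n * (k + a t) + n + 1) - s)"
      by (auto simp: fun_eq_iff)
    then have ran: "(\<lambda>s. n * (k + a t) + (n + 1 - s)) ` level n a t
        = {n * (k + a t) + n + 1 - q..n * (k + a t) + n + 1 - p}"
      unfolding L by (simp only: image_diff_atLeastAtMost)
    have s: "a s = a t \<and> block_flip n a s = p + q - s" if "s \<in> level n a t" for s
      using that level_cong[OF that] by (auto simp: block_flip_def p_def q_def level_def)
    have "(\<forall>x\<in>{n * k + p..n * k + q}. w x = x - (n * k + p) + (n * (k + a t) + n + 1 - q)) \<longleftrightarrow>
       (\<forall>s\<in>level n a t. w (n * k + s) = s - p + (n * (k + a t) + n + 1 - q))"
      unfolding dom[symmetric] by simp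
    also have "\<dots> \<longleftrightarrow>
        (\<forall>s\<in>level n a t. w (n * k + s) = n * (k + a s) + (n + 1 - block_flip n a s))"
      using s by (intro ball_cong) auto
    finally show ?thesis unfolding dom ran by (subst bij_mono_interval_iff) auto
  qed
  \<comment> \<open>Blocks are nonempty, so the universally quantified \<open>v\<close> can only be
    the common value.\<close>
  have val: "(\<forall>s\<in>level n a t. a s = v) \<longleftrightarrow> v = a t" if "t \<in> {1..n}" for t v
    using level_self[OF that] by (auto simp: level_def)
  have "seq_map_spec n a w \<longleftrightarrow> (\<forall>t\<in>{1..n}. \<forall>k.
    (\<forall>s\<in>level n a t. w (n * k + s) = n * (k + a s) + (n + 1 - block_flip n a s)))"
    unfolding seq_map_spec_def blocks_eq_levels[OF mono] using val block by simp
  also have "\<dots> \<longleftrightarrow>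
    (\<forall>t\<in>{1..n}. \<forall>k. w (n * k + t) = n * (k + a t) + (n + 1 - block_flip n a t))"
    using level_self by (fastforce simp: level_def)
  finally show ?thesis .
qed

text \<open>Division with remainders in \<open>{1..n}\<close> instead of \<open>{0..n - 1}\<close>,
  whence the shifts by one around \<open>div\<close> and \<open>mod\<close>.\<close>

lemma int_decomp:
  fixes n j :: int
  assumes "n \<ge> 1"
  obtains k t where "t \<in> {1..n}" "j = n * k + t"
proof
  show "(j - 1) mod n + 1 \<in> {1..n}" using assms by (simp add: add1_zle_eq)
  show "j = n * ((j - 1) div n) + ((j - 1) mod n + 1)" by (simp add: algebra_simps)
qed

lemma div_decomp:
  fixes n k t :: int
  assumes "t \<in> {1..n}"
  shows "(n * k + t - 1) div n = k"
proof -
  have "n * k + t - 1 = (t - 1) + n * k" by simp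
  then show ?thesis using assms by (simp only: div_mult_self2) simp
qed

lemma seq_map_spec_unique:
  assumes n: "n \<ge> 1" and mono: "mono_on {1..n} a"
    and "seq_map_spec n a w" "seq_map_spec n a w'"
  shows "w = w'"
proof
  fix j
  obtain k t where "t \<in> {1..n}" "j = n * k + t" using int_decomp[OF n] .
  then show "w j = w' j" using assms(3,4) by (simp add: seq_map_spec_iff[OF mono])
qed

lemma seq_map_eqI:
  assumes "n \<ge> 1" "mono_on {1..n} a" "seq_map_spec n a w"
  shows "seq_map n a = w"
  unfolding seq_map_def seq_map_spec_def[symmetric]
  using assms seq_map_spec_unique by (intro the_equality) auto

lemma seq_map_apply:
  assumes n: "n \<ge> 1" and mono: "mono_on {1..n} a" and t: "t \<in> {1..n}"
  shows "seq_map n a (n * k + t) = n * (k + a t) + (n + 1 - block_flip n a t)"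
proof -
  \<comment> \<open>\<open>W\<close> reads the formula as a definition. It shows that the
    description is satisfiable, and uniqueness then identifies it with
    \<open>seq_map n a\<close>.\<close>
  define W where "W j = (let k = (j - 1) div n; t = j - n * k
      in n * (k + a t) + (n + 1 - block_flip n a t))" for j
  have W: "W (n * k + t) = n * (k + a t) + (n + 1 - block_flip n a t)" if "t \<in> {1..n}" for t k
    using div_decomp[OF that] by (simp add: W_def Let_def)
  then have "seq_map_spec n a W" using seq_map_spec_iff[OF mono] by blast
  then show ?thesis using seq_map_eqI[OF n mono] W t by simp
qed

section \<open>From sequences to involutions\<close>

lemma zero_sum_seqsD:
  assumes "a \<in> zero_sum_seqs n"
  shows "a \<in> {1..n} \<rightarrow>\<^sub>E UNIV" "mono_on {1..n} a" "(\<Sum>i\<in>{1..n}. a i) = 0"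
  using assms by (auto simp: zero_sum_seqs_def int_seqs_def)

lemma sum_reverse_int: "(\<Sum>i\<in>{1..n::int}. f (n + 1 - i)) = (\<Sum>i\<in>{1..n}. f i)"
  by (rule sum.reindex_bij_witness[of _ "\<lambda>i. n + 1 - i" "\<lambda>i. n + 1 - i"]) auto

lemma antisymmetric_subset_zero_sum: "antisymmetric_seqs n \<subseteq> zero_sum_seqs n"
proof
  fix a assume a: "a \<in> antisymmetric_seqs n"
  then have "(\<Sum>i\<in>{1..n}. a i + a (n + 1 - i)) = 0"
    by (intro sum.neutral) (auto simp: antisymmetric_seqs_def antisymmetric_seq_def)
  then have "(\<Sum>i\<in>{1..n}. a i) = 0"
    using sum_reverse_int[of a n] by (simp add: sum.distrib)
  then show "a \<in> zero_sum_seqs n"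
    using a by (simp add: antisymmetric_seqs_def zero_sum_seqs_def)
qed

lemma block_flip_bij:
  assumes "mono_on {1..n} a"
  shows "bij_betw (block_flip n a) {1..n} {1..n}"
  using block_flip[OF assms]
  by (intro bij_betw_byWitness[where f' = "block_flip n a"]) auto

text \<open>Followed by the reversal, \<open>seq_map n a\<close> sends \<open>n * k + t\<close> to
  \<open>n * (- k - a t) + block_flip n a t\<close>. The flip is an involution that preserves
  \<open>a t\<close>, so a second application restores both quotient and remainder.\<close>

lemma seq_map_rev_invol:
  assumes n: "n \<ge> 1" and mono: "mono_on {1..n} a"
  shows "n + 1 - seq_map n a (n + 1 - seq_map n a j) = j"
proof -
  obtain k t where t: "t \<in> {1..n}" "j = n * k + t" using int_decomp[OF n] .
  have "n + 1 - seq_map n a j = n * (- k - a t) + block_flip n a t"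
    using seq_map_apply[OF n mono t(1)] t(2) by (simp add: algebra_simps)
  then have "seq_map n a (n + 1 - seq_map n a j) = n * (- k - a t + a t) + (n + 1 - t)"
    using seq_map_apply[OF n mono, of "block_flip n a t"] block_flip[OF mono t(1)] by simp
  then show ?thesis using t(2) by simp
qed

lemma seq_map_affine:
  assumes n: "n \<ge> 1" and a: "a \<in> zero_sum_seqs n"
  shows "seq_map n a \<in> affine_sym n"
proof -
  note mono = zero_sum_seqsD(2)[OF a]
  let ?w = "seq_map n a"
  have inv': "?w (n + 1 - ?w (n + 1 - j)) = j" for j
    using seq_map_rev_invol[OF n mono, of "n + 1 - j"] by simp
  have "bij ?w"
  proof (rule o_bij)
    show "(\<lambda>j. n + 1 - ?w (n + 1 - j)) \<circ> ?w = id" "?w \<circ> (\<lambda>j. n + 1 - ?w (n + 1 - j)) = id"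
      using seq_map_rev_invol[OF n mono] inv' by (auto simp: fun_eq_iff)
  qed
  moreover have "?w (j + n) = ?w j + n" for j
  proof -
    obtain k t where t: "t \<in> {1..n}" "j = n * k + t" using int_decomp[OF n] .
    then have "j + n = n * (k + 1) + t" by (simp add: algebra_simps)
    then show ?thesis
      using t seq_map_apply[OF n mono t(1), of k] seq_map_apply[OF n mono t(1), of "k + 1"]
      by (simp add: algebra_simps)
  qed
  moreover have "(\<Sum>i\<in>{1..n}. ?w i) = (\<Sum>i\<in>{1..n}. i)"
  proof -
    have "(\<Sum>i\<in>{1..n}. ?w i) = (\<Sum>i\<in>{1..n}. n * a i + (n + 1 - block_flip n a i))"
      using seq_map_apply[OF n mono, of _ 0] by (intro sum.cong) auto
    also have "\<dots> = n * (\<Sum>i\<in>{1..n}. a i) + (\<Sum>i\<in>{1..n}. n + 1 - block_flip n a i)"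
      by (simp add: sum.distrib sum_distrib_left)
    also have "(\<Sum>i\<in>{1..n}. n + 1 - block_flip n a i) = (\<Sum>i\<in>{1..n}. n + 1 - i)"
      by (rule sum.reindex_bij_betw[OF block_flip_bij[OF mono]])
    also have "\<dots> = (\<Sum>i\<in>{1..n}. i)" by (rule sum_reverse_int)
    finally show ?thesis using zero_sum_seqsD(3)[OF a] by simp
  qed
  ultimately show ?thesis by (simp add: affine_sym_def)
qed

text \<open>Within a block the map is a translation. From one block to a later one \<open>a\<close>
  grows by at least one, which adds at least \<open>n\<close> and outweighs any change of
  remainder.\<close>

lemma seq_map_increasing:
  assumes n: "n \<ge> 1" and mono: "mono_on {1..n} a"
  shows "strict_mono_on {1..n} (seq_map n a)"
proof (rule strict_mono_onI)
  fix r s assume rs: "r \<in> {1..n}" "s \<in> {1..n}" "r < s"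
  have w: "seq_map n a t = n * a t + (n + 1 - block_flip n a t)" if "t \<in> {1..n}" for t
    using seq_map_apply[OF n mono that, of 0] by simp
  have le: "a r \<le> a s" using rs mono by (auto intro: mono_onD)
  show "seq_map n a r < seq_map n a s"
  proof (cases "a r = a s")
    case True
    then have "level n a r = level n a s" by (simp add: level_def)
    then show ?thesis using w rs True by (simp add: block_flip_def)
  next
    case False
    then have "n * (a r + 1) \<le> n * a s" using le n by (intro mult_left_mono) auto
    then show ?thesis
      using w[OF rs(1)] w[OF rs(2)] block_flip(2)[OF mono rs(1)] block_flip(2)[OF mono rs(2)]
      by (simp add: algebra_simps)
  qed
qed

lemma seq_map_Omega':
  assumes n: "n \<ge> 2" and a: "a \<in> zero_sum_seqs n"
  shows "seq_map n a \<in> Omega' n"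
proof -
  note mono = zero_sum_seqsD(2)[OF a]
  let ?w = "seq_map n a" and ?u = "\<lambda>j. n + 1 - seq_map n a (n + 1 - j)"
  have n1: "n \<ge> 1" using n by simp
  have inv: "n + 1 - ?w (n + 1 - ?w j) = j" for j by (rule seq_map_rev_invol[OF n1 mono])
  have "?w (?u j) = j" for j using inv[of "n + 1 - j"] by simp
  then have "?w \<circ> ?u = id" "?u \<circ> ?w = id" using inv by (auto simp: fun_eq_iff)
  moreover have inc: "strict_mono_on {1..n} ?w" by (rule seq_map_increasing[OF n1 mono])
  \<comment> \<open>Conjugation by an order-reversing map keeps a map increasing.\<close>
  moreover have "strict_mono_on {1..n} ?u"
    using strict_mono_onD[OF inc] by (intro strict_mono_onI) auto
  ultimately have "min_double_coset_elem n ?w"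
    using min_double_coset_increasingI[OF n seq_map_affine[OF n1 a]] by blast
  moreover have "(rev_map n \<circ> ?w) \<circ> (rev_map n \<circ> ?w) = id"
    using inv by (auto simp: fun_eq_iff rev_map_def)
  ultimately show ?thesis using seq_map_affine[OF n1 a] by (simp add: Omega'_def)
qed

text \<open>Under antisymmetry the reversal carries blocks to blocks and negates their values, so it
  commutes with \<open>block_flip\<close>. Applying the formula twice then cancels the quotients and
  undoes the flip; the length condition comes from \<open>seq_map_Omega'\<close>.\<close>

lemma seq_map_Omega:
  assumes n: "n \<ge> 2" and a: "a \<in> antisymmetric_seqs n"
  shows "seq_map n a \<in> Omega n"
proof -
  have z: "a \<in> zero_sum_seqs n" using a antisymmetric_subset_zero_sum by blast
  note mono = zero_sum_seqsD(2)[OF z]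
  have n1: "n \<ge> 1" using n by simp
  have anti: "a (n + 1 - s) = - a s" if "s \<in> {1..n}" for s
  proof -
    have "a s + a (n + 1 - s) = 0"
      using a that unfolding antisymmetric_seqs_def antisymmetric_seq_def by blast
    then show ?thesis by linarith
  qed
  have flip: "block_flip n a (n + 1 - s) = n + 1 - block_flip n a s" if s: "s \<in> {1..n}" for s
  proof -
    define p where "p = Min (level n a s)"
    define q where "q = Max (level n a s)"
    have L: "level n a s = {p..q}" using level_interval[OF mono s] by (simp add: p_def q_def)
    have pq: "p \<le> q" using L level_self[OF s, of a] by auto
    have "x \<in> level n a (n + 1 - s) \<longleftrightarrow> n + 1 - x \<in> level n a s" for x
    proof (cases "x \<in> {1..n}")
      case True
      then have "n + 1 - x \<in> {1..n}" by simp
      then show ?thesis using True anti[OF True] anti[OF s] s by (auto simp: level_def)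
    next
      case False
      then have "n + 1 - x \<notin> {1..n}" by auto
      then show ?thesis using False by (simp only: level_def mem_Collect_eq simp_thms)
    qed
    then have "x \<in> level n a (n + 1 - s) \<longleftrightarrow> x \<in> {n + 1 - q..n + 1 - p}" for x
      by (simp only: L atLeastAtMost_iff) linarith
    then have "level n a (n + 1 - s) = {n + 1 - q..n + 1 - p}" by blast
    moreover have "Min {n + 1 - q..n + 1 - p} = n + 1 - q"
      by (rule Min_eqI) (use pq in simp_all)
    moreover have "Max {n + 1 - q..n + 1 - p} = n + 1 - p"
      by (rule Max_eqI) (use pq in simp_all)
    ultimately have "block_flip n a (n + 1 - s) = (n + 1 - q) + (n + 1 - p) - (n + 1 - s)"
      by (simp only: block_flip_def)
    then show ?thesis by (simp add: block_flip_def flip: p_def q_def)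
  qed
  have "seq_map n a (seq_map n a j) = j" for j
  proof -
    obtain k t where t: "t \<in> {1..n}" "j = n * k + t" using int_decomp[OF n1] .
    let ?s = "block_flip n a t"
    note s = block_flip[OF mono t(1)]
    have "n + 1 - ?s \<in> {1..n}" using s(2) by auto
    then have "seq_map n a (n * (k + a t) + (n + 1 - ?s))
        = n * (k + a t + a (n + 1 - ?s)) + (n + 1 - block_flip n a (n + 1 - ?s))"
      by (rule seq_map_apply[OF n1 mono])
    also have "\<dots> = n * k + t" using anti[OF s(2)] flip[OF s(2)] s by simp
    finally show ?thesis using seq_map_apply[OF n1 mono t(1)] t(2) by simp
  qed
  then show ?thesis using seq_map_Omega'[OF n z] by (auto simp: Omega_def Omega'_def fun_eq_iff)
qed

lemma lambda_seq_map:
  assumes n: "n \<ge> 1" and a: "a \<in> zero_sum_seqs n"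
  shows "lambda_seq n (seq_map n a) = a"
proof
  note mono = zero_sum_seqsD(2)[OF a]
  fix t
  show "lambda_seq n (seq_map n a) t = a t"
  proof (cases "t \<in> {1..n}")
    case True
    have "n + 1 - block_flip n a t \<in> {1..n}" using block_flip(2)[OF mono True] by auto
    then show ?thesis
      using seq_map_apply[OF n mono True, of 0] div_decomp True by (simp add: lambda_seq_def)
  next
    case False
    \<comment> \<open>Outside \<open>{1..n}\<close> both sides are \<open>undefined\<close>.\<close>
    then show ?thesis
      using PiE_arb[OF zero_sum_seqsD(1)[OF a]] by (auto simp: lambda_seq_def)
  qed
qed

section \<open>From involutions to sequences\<close>

text \<open>The permutation \<open>\<sigma>\<close> of the overview, with remainders in
  \<open>{1..n}\<close>.\<close>

definition residue_perm :: "int \<Rightarrow> (int \<Rightarrow> int) \<Rightarrow> int \<Rightarrow> int" where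
  "residue_perm n w t = (w t - 1) mod n + 1"

lemma residue_decomp:
  assumes "t \<in> {1..n}"
  shows "w t = n * lambda_seq n w t + residue_perm n w t"
  using assms by (simp add: lambda_seq_def residue_perm_def algebra_simps)

lemma residue_perm_range: "n \<ge> 1 \<Longrightarrow> residue_perm n w t \<in> {1..n}"
  by (simp add: residue_perm_def add1_zle_eq)

lemma affine_sym_shift:
  assumes "w \<in> affine_sym n"
  shows "w (n * k + j) = n * k + w j"
  using periodic_shift[of w n j k] affine_symD(3)[OF assms] by (simp add: add.commute)

text \<open>If two remainders agree, the values of \<open>w\<close> differ by a multiple of
  \<open>n\<close>; by injectivity so do the arguments, which therefore coincide in
  \<open>{1..n}\<close>. Finiteness gives surjectivity.\<close>

lemma residue_perm_bij:
  assumes n: "n \<ge> 1" and w: "w \<in> affine_sym n"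
  shows "bij_betw (residue_perm n w) {1..n} {1..n}"
proof -
  have "inj_on (residue_perm n w) {1..n}"
  proof (rule inj_onI)
    fix s t assume st: "s \<in> {1..n}" "t \<in> {1..n}" "residue_perm n w s = residue_perm n w t"
    let ?d = "lambda_seq n w s - lambda_seq n w t"
    have "w s = w (n * ?d + t)"
      using residue_decomp[OF st(1), of w] residue_decomp[OF st(2), of w] st(3)
        affine_sym_shift[OF w, of ?d t] by (simp add: right_diff_distrib)
    then have "s = n * ?d + t" using affine_symD(2)[OF w] by (simp add: inj_eq)
    moreover have "(n * 0 + s - 1) div n = 0" using div_decomp[OF st(1)] .
    moreover have "(n * ?d + t - 1) div n = ?d" using div_decomp[OF st(2)] .
    ultimately show "s = t" by simp
  qed
  moreover have "residue_perm n w ` {1..n} \<subseteq> {1..n}" using residue_perm_range[OF n] by blast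
  ultimately show ?thesis using endo_inj_surj[of "{1..n}"] by (auto simp: bij_betw_def)
qed

lemma lambda_seq_mono:
  assumes "n \<ge> 1" "strict_mono_on {1..n} w"
  shows "mono_on {1..n} (lambda_seq n w)"
proof (rule mono_onI)
  fix r s assume rs: "r \<in> {1..n}" "s \<in> {1..n}" "r \<le> s"
  then have "w r \<le> w s" using strict_mono_onD[OF assms(2), of r s] by (cases "r = s") auto
  then show "lambda_seq n w r \<le> lambda_seq n w s"
    using rs assms(1) by (simp add: lambda_seq_def zdiv_mono1)
qed

lemma lambda_seq_sum:
  assumes n: "n \<ge> 1" and w: "w \<in> affine_sym n"
  shows "(\<Sum>i\<in>{1..n}. lambda_seq n w i) = 0"
proof -
  have "(\<Sum>i\<in>{1..n}. w i) = (\<Sum>i\<in>{1..n}. n * lambda_seq n w i + residue_perm n w i)"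
    using residue_decomp by (intro sum.cong) auto
  also have "\<dots> = n * (\<Sum>i\<in>{1..n}. lambda_seq n w i) + (\<Sum>i\<in>{1..n}. residue_perm n w i)"
    by (simp add: sum.distrib sum_distrib_left)
  also have "(\<Sum>i\<in>{1..n}. residue_perm n w i) = (\<Sum>i\<in>{1..n}. i)"
    by (rule sum.reindex_bij_betw[OF residue_perm_bij[OF n w]])
  finally show ?thesis using affine_symD(4)[OF w] n by simp
qed

lemma lambda_seq_zero_sum:
  assumes "n \<ge> 1" "w \<in> affine_sym n" "strict_mono_on {1..n} w"
  shows "lambda_seq n w \<in> zero_sum_seqs n"
  using lambda_seq_mono[OF assms(1,3)] lambda_seq_sum[OF assms(1,2)]
  by (simp add: zero_sum_seqs_def int_seqs_def lambda_seq_def)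

text \<open>On each block, \<open>residue_perm\<close> followed by the reversal is an injective self-map, hence
  onto, and it is decreasing; this forces it to be the flip of the block.\<close>

lemma seq_map_lambda:
  assumes n: "n \<ge> 1" and w: "w \<in> affine_sym n" and inc: "strict_mono_on {1..n} w"
    and lam: "\<And>t. t \<in> {1..n} \<Longrightarrow> lambda_seq n w (n + 1 - residue_perm n w t) = lambda_seq n w t"
  shows "seq_map n (lambda_seq n w) = w"
proof (rule seq_map_eqI[OF n])
  let ?a = "lambda_seq n w" and ?r = "residue_perm n w"
  show mono: "mono_on {1..n} ?a" by (rule lambda_seq_mono[OF n inc])
  have "?r t = n + 1 - block_flip n ?a t" if t: "t \<in> {1..n}" for t
  proof -
    let ?L = "level n ?a t"
    let ?f = "\<lambda>s. n + 1 - ?r s"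
    define p where "p = Min ?L"
    define q where "q = Max ?L"
    have L: "?L = {p..q}" using level_interval[OF mono t] by (simp add: p_def q_def)
    have "?f s \<in> ?L" if "s \<in> ?L" for s
      using that lam[of s] residue_perm_range[OF n, of w s] by (auto simp: level_def)
    then have "?f ` ?L \<subseteq> ?L" by blast
    moreover have inj: "inj_on ?r ?L"
      using residue_perm_bij[OF n w] by (auto simp: bij_betw_def level_def intro: inj_on_subset)
    then have "inj_on ?f ?L" by (auto simp: inj_on_def)
    ultimately have f: "?f ` ?L = ?L" using endo_inj_surj[of ?L ?f] by simp
    have "?r ` ?L = (\<lambda>s. n + 1 - s) ` ?f ` ?L" by (simp add: image_image)
    also have "\<dots> = {n + 1 - q..n + 1 - p}"
      unfolding f by (simp only: L image_diff_atLeastAtMost)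
    finally have "bij_betw ?r {p..q} {n + 1 - q..n + 1 - p}"
      using inj L by (simp add: bij_betw_def)
    \<comment> \<open>On a block \<open>w\<close> and \<open>?r\<close> differ by a constant, so
      \<open>?r\<close> inherits monotonicity from \<open>w\<close>.\<close>
    moreover have "mono_on {p..q} ?r"
    proof (rule mono_onI)
      fix x y assume xy: "x \<in> {p..q}" "y \<in> {p..q}" "x \<le> y"
      then have xy': "x \<in> {1..n}" "y \<in> {1..n}" "?a x = ?a y"
        unfolding L[symmetric] by (auto simp: level_def)
      then have "w x \<le> w y"
        using strict_mono_onD[OF inc, of x y] xy(3) by (cases "x = y") auto
      then show "?r x \<le> ?r y" using residue_decomp[OF xy'(1), of w]
          residue_decomp[OF xy'(2), of w] xy'(3) by simp
    qed
    ultimately have "\<forall>x\<in>{p..q}. ?r x = x - p + (n + 1 - q)"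
      using bij_mono_interval_iff[of q p "n + 1 - p" "n + 1 - q" ?r] by simp
    moreover have "t \<in> {p..q}" using level_self[OF t] L by blast
    ultimately show ?thesis by (simp add: block_flip_def flip: p_def q_def)
  qed
  then show "seq_map_spec n ?a w"
    using residue_decomp[of _ n w] affine_sym_shift[OF w]
    by (simp add: seq_map_spec_iff[OF mono] algebra_simps)
qed

section \<open>The two involution conditions in terms of quotients and remainders\<close>

text \<open>The reversal of \<open>w t\<close> has quotient \<open>- ?a t\<close> and remainder
  \<open>?s\<close>. Applying \<open>w\<close> and reversing once more must return \<open>t\<close>,
  which forces \<open>w ?s\<close> to have quotient \<open>?a t\<close>.\<close>

lemma Omega'_lambda_flip:
  assumes n: "n \<ge> 1" and w: "w \<in> Omega' n" and t: "t \<in> {1..n}"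
  shows "lambda_seq n w (n + 1 - residue_perm n w t) = lambda_seq n w t"
proof -
  let ?a = "lambda_seq n w" and ?s = "n + 1 - residue_perm n w t"
  have aff: "w \<in> affine_sym n" using w by (simp add: Omega'_def)
  have s: "?s \<in> {1..n}" using residue_perm_range[OF n, of w t] by auto
  have "n + 1 - w (n + 1 - w t) = t"
    using w by (auto simp: Omega'_def rev_map_def fun_eq_iff)
  moreover have "n + 1 - w t = n * (- ?a t) + ?s" using residue_decomp[OF t, of w] by simp
  ultimately have "w ?s = n * ?a t + (n + 1 - t)"
    using affine_sym_shift[OF aff, of "- ?a t" ?s] by simp
  moreover have "n + 1 - t \<in> {1..n}" using t by auto
  ultimately show ?thesis using div_decomp s by (simp add: lambda_seq_def)
qed

text \<open>Applying \<open>w\<close> to \<open>w t\<close> must return \<open>t\<close>, whose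
  quotient is zero, so the quotient at the remainder cancels the one at \<open>t\<close>.\<close>

lemma Omega_lambda_neg:
  assumes n: "n \<ge> 1" and w: "w \<in> Omega n" and t: "t \<in> {1..n}"
  shows "lambda_seq n w (residue_perm n w t) = - lambda_seq n w t"
proof -
  let ?a = "lambda_seq n w" and ?s = "residue_perm n w t"
  have aff: "w \<in> affine_sym n" using w by (simp add: Omega_def)
  have s: "?s \<in> {1..n}" by (rule residue_perm_range[OF n])
  have "w (w t) = t" using w by (auto simp: Omega_def fun_eq_iff)
  then have "w ?s = n * (- ?a t) + t"
    using affine_sym_shift[OF aff, of "?a t" ?s] residue_decomp[OF t, of w] by simp
  then show ?thesis using div_decomp[OF t, of "- ?a t"] s by (simp add: lambda_seq_def)
qed

text \<open>The multiset of values of \<open>a\<close> is symmetric about \<open>0\<close>, so sorting forces antisymmetry; the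
  proof compares the sizes of upper and lower level sets.\<close>

lemma antisymmetric_of_neg_perm:
  assumes mono: "mono_on {1..n} a" and bij: "bij_betw r {1..n} {1..n}"
    and neg: "\<And>t. t \<in> {1..n} \<Longrightarrow> a (r t) = - a t"
  shows "antisymmetric_seq n a"
  unfolding antisymmetric_seq_def
proof
  fix i assume i: "i \<in> {1..n}"
  let ?i' = "n + 1 - i"
  have i': "?i' \<in> {1..n}" using i by auto
  have inj: "inj_on r {1..n}" using bij by (simp add: bij_betw_def)
  have r: "r t \<in> {1..n}" if "t \<in> {1..n}" for t using that bij bij_betwE by blast
  have less: "s < t" if "a s < a t" "s \<in> {1..n}" "t \<in> {1..n}" for s t
    using that mono_onD[OF mono, of t s] by fastforce
  have "a i + a ?i' \<le> 0"
  proof (rule ccontr)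
    assume pos: "\<not> ?thesis"
    \<comment> \<open>Pigeonhole: the \<open>n - i + 1\<close> positions from \<open>i\<close> on
      carry values above \<open>- a ?i'\<close>, so \<open>r\<close> sends them to values below
      \<open>a ?i'\<close>, that is, to only \<open>n - i\<close> positions.\<close>
    have "r t \<in> {1..n - i}" if "t \<in> {i..n}" for t
    proof -
      have "a i \<le> a t" using mono_onD[OF mono, of i t] i that by auto
      then have "a (r t) < a ?i'" using neg[of t] pos i that by auto
      then show ?thesis using less[OF _ r i', of t] r[of t] i that by auto
    qed
    then have "r ` {i..n} \<subseteq> {1..n - i}" by blast
    moreover have "inj_on r {i..n}" using inj by (rule inj_on_subset) (use i in auto)
    ultimately have "card {i..n} \<le> card {1..n - i}" by (intro card_inj_on_le) auto
    then have "nat (n - i + 1) \<le> nat (n - i)" by (simp add: add.commute)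
    then show False using i by (simp add: nat_le_eq_zle)
  qed
  moreover have "a i + a ?i' \<ge> 0"
  proof (rule ccontr)
    assume pos: "\<not> ?thesis"
    \<comment> \<open>The mirror image: \<open>i\<close> positions would be sent injectively to the
      \<open>i - 1\<close> positions after \<open>?i'\<close>.\<close>
    have "r t \<in> {n + 2 - i..n}" if "t \<in> {1..i}" for t
    proof -
      have "a t \<le> a i" using mono_onD[OF mono, of t i] i that by auto
      then have "a ?i' < a (r t)" using neg[of t] pos i that by auto
      then show ?thesis using less[OF _ i' r, of t] r[of t] i that by auto
    qed
    then have "r ` {1..i} \<subseteq> {n + 2 - i..n}" by blast
    moreover have "inj_on r {1..i}" using inj by (rule inj_on_subset) (use i in auto)
    ultimately have "card {1..i} \<le> card {n + 2 - i..n}" by (intro card_inj_on_le) auto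
    then have "nat i \<le> nat (i - 1)" by simp
    then show False using i by (simp add: nat_le_eq_zle)
  qed
  ultimately show "a i + a (n + 1 - i) = 0" by simp
qed

lemma Omega_lambda_antisymmetric:
  assumes n: "n \<ge> 2" and w: "w \<in> Omega n"
  shows "lambda_seq n w \<in> antisymmetric_seqs n"
proof -
  have n1: "n \<ge> 1" using n by simp
  have aff: "w \<in> affine_sym n" "strict_mono_on {1..n} w"
    using w min_double_coset_increasing[OF n] by (auto simp: Omega_def)
  have "lambda_seq n w \<in> zero_sum_seqs n" by (rule lambda_seq_zero_sum[OF n1 aff])
  moreover from this have "antisymmetric_seq n (lambda_seq n w)"
    using residue_perm_bij[OF n1 aff(1)] Omega_lambda_neg[OF n1 w]
    by (intro antisymmetric_of_neg_perm[where r = "residue_perm n w"])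
      (auto simp: zero_sum_seqs_def)
  ultimately show ?thesis by (simp add: zero_sum_seqs_def antisymmetric_seqs_def)
qed

lemma mutually_inverse_bijectionsI:
  assumes "\<And>x. x \<in> A \<Longrightarrow> f x \<in> B" "\<And>y. y \<in> B \<Longrightarrow> g y \<in> A"
    and "\<And>x. x \<in> A \<Longrightarrow> g (f x) = x" "\<And>y. y \<in> B \<Longrightarrow> f (g y) = y"
  shows "mutually_inverse_bijections f g A B"
proof -
  have "bij_betw f A B" by (rule bij_betw_byWitness[where f' = g]) (use assms in auto)
  moreover have "bij_betw g B A" by (rule bij_betw_byWitness[where f' = f]) (use assms in auto)
  ultimately show ?thesis unfolding mutually_inverse_bijections_def using assms by blast
qed

theorem theorem2p13:
  fixes n :: int
  assumes "n \<ge> 2"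
  shows "mutually_inverse_bijections (lambda_seq n) (seq_map n) (Omega' n) (zero_sum_seqs n)
       \<and> mutually_inverse_bijections (lambda_seq n) (seq_map n) (Omega n) (antisymmetric_seqs n)"
proof (intro conjI mutually_inverse_bijectionsI)
  have n1: "n \<ge> 1" using assms by simp
  fix w
  {
    assume w: "w \<in> Omega' n"
    then have aff: "w \<in> affine_sym n" "strict_mono_on {1..n} w"
      using min_double_coset_increasing[OF assms] by (auto simp: Omega'_def)
    show "lambda_seq n w \<in> zero_sum_seqs n" by (rule lambda_seq_zero_sum[OF n1 aff])
    show "seq_map n (lambda_seq n w) = w"
      using seq_map_lambda[OF n1 aff] Omega'_lambda_flip[OF n1 w] by blast
  next
    assume w: "w \<in> Omega n"
    then have aff: "w \<in> affine_sym n" "strict_mono_on {1..n} w"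
      using min_double_coset_increasing[OF assms] by (auto simp: Omega_def)
    show anti: "lambda_seq n w \<in> antisymmetric_seqs n"
      by (rule Omega_lambda_antisymmetric[OF assms w])
    \<comment> \<open>The sign change under \<open>residue_perm\<close> and the sign change under
      the reversal cancel, which is the block condition required by
      \<open>seq_map_lambda\<close>.\<close>
    have "lambda_seq n w (n + 1 - residue_perm n w t) = lambda_seq n w t" if "t \<in> {1..n}" for t
    proof -
      have "lambda_seq n w (residue_perm n w t) + lambda_seq n w (n + 1 - residue_perm n w t) = 0"
        using anti residue_perm_range[OF n1]
        unfolding antisymmetric_seqs_def antisymmetric_seq_def by blast
      then show ?thesis using Omega_lambda_neg[OF n1 w that] by simp
    qed
    then show "seq_map n (lambda_seq n w) = w" by (rule seq_map_lambda[OF n1 aff])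
  }
next
  have n1: "n \<ge> 1" using assms by simp
  fix a
  {
    assume a: "a \<in> zero_sum_seqs n"
    show "seq_map n a \<in> Omega' n" by (rule seq_map_Omega'[OF assms a])
    show "lambda_seq n (seq_map n a) = a" by (rule lambda_seq_map[OF n1 a])
  next
    assume a: "a \<in> antisymmetric_seqs n"
    show "seq_map n a \<in> Omega n" by (rule seq_map_Omega[OF assms a])
    show "lambda_seq n (seq_map n a) = a"
      using lambda_seq_map[OF n1] a antisymmetric_subset_zero_sum by blast
  }
qed

end
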